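(* Let $k$ be a finite field with $q$ elements and let $d$ be an integer with $q\ge d\ge4$. Let $A$ be a nonsingular $d\times d$ matrix over $k$. Then there exists a vector $v\in k^d$ such that both $v$ and $Av$ have no zero component. *)

theory Defs
  imports "Jordan_Normal_Form.Determinant"
begin

end

theory Submission
  imports Defs "HOL-Library.Cardinality"
begin

text \<open>
  Fix all coordinates of \<open>v\<close> but the \<open>j\<close>-th. Every row with a nonzero entry in column \<open>j\<close> then forbids
  one value of \<open>v\<^sub>j\<close>, and a suitable nonzero value remains as soon as at most \<open>q - 2\<close> values
  are forbidden. A column with a zero forbids at most \<open>q - 1\<close> values; if it has at least three nonzero
  entries, the other coordinates can be chosen so that two of the forbidden values coincide, and if it
  has one or two, one inducts on the rows that vanish there. If \<open>A\<close> has no zero entry, pass to the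
  inverse matrix; if that has no zero entry either, then no coordinate form is a combination of three
  rows, which allows the values forbidden by three rows to be made equal.
\<close>

section \<open>Choosing coordinates one at a time\<close>

definition independent_rows :: "'i set \<Rightarrow> 'j set \<Rightarrow> ('i \<Rightarrow> 'j \<Rightarrow> 'k::field) \<Rightarrow> bool" where
  "independent_rows I J a \<longleftrightarrow>
    (\<forall>c. (\<forall>j\<in>J. (\<Sum>i\<in>I. c i * a i j) = 0) \<longrightarrow> (\<forall>i\<in>I. c i = 0))"

lemma exists_nonzero_notin:
  fixes S :: "'k::{field,finite} set"
  assumes "card S + 2 \<le> CARD('k)"
  shows "\<exists>t. t \<noteq> 0 \<and> t \<notin> S"
proof -
  have "card (insert 0 S) < CARD('k)"
    using assms card_insert_le_m1[of "card S + 1" S 0] by simp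
  then have "insert 0 S \<noteq> UNIV" by auto
  then show ?thesis by auto
qed

text \<open>With \<open>- t\<close> as the new coordinate, row \<open>i\<close> vanishes exactly
  when \<open>t\<close> equals its quotient in \<open>few\<close>. The hypothesis counts the image
  and not the rows, so coinciding quotients count once; all later arguments exploit this.\<close>

lemma extend_nonvanishing:
  fixes a :: "'i \<Rightarrow> 'j \<Rightarrow> 'k::{field,finite}"
  assumes J: "finite J" "j \<notin> J"
    and x: "\<forall>k\<in>J. x k \<noteq> 0"
    and zero: "\<And>i. i \<in> I \<Longrightarrow> a i j = 0 \<Longrightarrow> (\<Sum>k\<in>J. a i k * x k) \<noteq> 0"
    and few: "card ((\<lambda>i. (\<Sum>k\<in>J. a i k * x k) / a i j) ` {i\<in>I. a i j \<noteq> 0}) + 2 \<le> CARD('k)"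
  shows "\<exists>y. (\<forall>k\<in>insert j J. y k \<noteq> 0) \<and> (\<forall>i\<in>I. (\<Sum>k\<in>insert j J. a i k * y k) \<noteq> 0)"
proof -
  obtain t where t: "t \<noteq> 0"
    "t \<notin> (\<lambda>i. (\<Sum>k\<in>J. a i k * x k) / a i j) ` {i\<in>I. a i j \<noteq> 0}"
    using exists_nonzero_notin[OF few] by blast
  define y where "y = x(j := - t)"
  have sum: "(\<Sum>k\<in>insert j J. a i k * y k) = (\<Sum>k\<in>J. a i k * x k) - a i j * t" for i
  proof -
    have "(\<Sum>k\<in>J. a i k * y k) = (\<Sum>k\<in>J. a i k * x k)"
      using J by (intro sum.cong) (auto simp: y_def)
    then show ?thesis using J by (simp add: y_def)
  qed
  have "(\<Sum>k\<in>insert j J. a i k * y k) \<noteq> 0" if "i \<in> I" for i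
  proof (cases "a i j = 0")
    case True
    then show ?thesis using zero[OF that] sum[of i] by simp
  next
    case False
    then have "t \<noteq> (\<Sum>k\<in>J. a i k * x k) / a i j" using t(2) that by blast
    with False show ?thesis unfolding sum by (auto simp: field_simps)
  qed
  moreover have "\<forall>k\<in>insert j J. y k \<noteq> 0" using x t J by (auto simp: y_def)
  ultimately show ?thesis by blast
qed

text \<open>Induction on the coordinates. A form that is zero on \<open>J\<close> must be nonzero at
  \<open>j\<close>, so it is left to the extension step, while the others are covered by the
  induction hypothesis. Each form forbids at most one value.\<close>

lemma nonvanishing_forms:
  fixes F :: "('j \<Rightarrow> 'k::{field,finite}) set"
  assumes "finite J" "finite F" "card F + 2 \<le> CARD('k)" "\<forall>f\<in>F. \<exists>k\<in>J. f k \<noteq> 0"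
  shows "\<exists>x. (\<forall>k\<in>J. x k \<noteq> 0) \<and> (\<forall>f\<in>F. (\<Sum>k\<in>J. f k * x k) \<noteq> 0)"
  using assms
proof (induction J arbitrary: F rule: finite_induct)
  case empty
  then show ?case by auto
next
  case (insert j J)
  define F' where "F' = {f\<in>F. \<exists>k\<in>J. f k \<noteq> 0}"
  have "card F' \<le> card F" unfolding F'_def using insert.prems by (intro card_mono) auto
  then obtain x where x: "\<forall>k\<in>J. x k \<noteq> 0" "\<forall>f\<in>F'. (\<Sum>k\<in>J. f k * x k) \<noteq> 0"
    using insert.IH[of F'] insert.prems by (fastforce simp: F'_def)
  have "card ((\<lambda>f. (\<Sum>k\<in>J. f k * x k) / f j) ` {f\<in>F. f j \<noteq> 0}) \<le> card {f\<in>F. f j \<noteq> 0}"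
    using insert.prems by (intro card_image_le) auto
  also have "\<dots> \<le> card F" using insert.prems by (intro card_mono) auto
  finally show ?case
    using insert x by (intro extend_nonvanishing[where a = "\<lambda>f. f" and x = x]) (auto simp: F'_def)
qed

text \<open>Solve \<open>g = 0\<close> for coordinate \<open>b\<close>: on the hyperplane, each
  \<open>f\<close> becomes the form \<open>h f\<close> in the other coordinates, nonzero because
  \<open>f\<close> is no multiple of \<open>g\<close>. Coordinate \<open>b\<close> itself is nonzero
  iff \<open>g\<close> restricted to \<open>J - {b}\<close> does not vanish at \<open>x\<close>. So
  \<open>g\<close> joins the list of forms, which raises the bound from 2 to 3, and \<open>c\<close>
  shows that this restriction is not the zero form.\<close>

lemma nowhere_zero_root:
  fixes F :: "('j \<Rightarrow> 'k::{field,finite}) set"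
  assumes J: "finite J" and F: "finite F" "card F + 3 \<le> CARD('k)"
    and b: "b \<in> J" "g b \<noteq> 0" and c: "c \<in> J" "g c \<noteq> 0" "c \<noteq> b"
    and multiple: "\<And>f s. f \<in> F \<Longrightarrow> \<exists>k\<in>J. f k \<noteq> s * g k"
  shows "\<exists>x. (\<forall>k\<in>J. x k \<noteq> 0) \<and> (\<Sum>k\<in>J. g k * x k) = 0 \<and> (\<forall>f\<in>F. (\<Sum>k\<in>J. f k * x k) \<noteq> 0)"
proof -
  define h where "h f k = f k - f b / g b * g k" for f k
  have "card (h ` F) \<le> card F" using F by (intro card_image_le)
  then have card: "card (insert g (h ` F)) + 2 \<le> CARD('k)"
    using F card_insert_le_m1[of "card F + 1" "h ` F" g] by simp
  have "\<exists>k\<in>J - {b}. h f k \<noteq> 0" if f: "f \<in> F" for f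
  proof -
    obtain k where k: "k \<in> J" "f k \<noteq> f b / g b * g k" using multiple[OF f] by blast
    then have "k \<noteq> b" using b by auto
    with k show ?thesis by (auto simp: h_def)
  qed
  then obtain x where x: "\<forall>k\<in>J - {b}. x k \<noteq> 0"
      "\<forall>f\<in>insert g (h ` F). (\<Sum>k\<in>J - {b}. f k * x k) \<noteq> 0"
    using nonvanishing_forms[of "J - {b}" "insert g (h ` F)"] J F card c by auto
  define y where "y = x(b := - (\<Sum>k\<in>J - {b}. g k * x k) / g b)"
  have yb: "y b = - (\<Sum>k\<in>J - {b}. g k * x k) / g b" by (simp add: y_def)
  have split: "(\<Sum>k\<in>J. f k * y k) = f b * y b + (\<Sum>k\<in>J - {b}. f k * x k)" for f
  proof -
    have "(\<Sum>k\<in>J - {b}. f k * y k) = (\<Sum>k\<in>J - {b}. f k * x k)"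
      by (intro sum.cong) (auto simp: y_def)
    then show ?thesis using sum.remove[OF J b(1), of "\<lambda>k. f k * y k"] by simp
  qed
  have "(\<Sum>k\<in>J. f k * y k) \<noteq> 0" if "f \<in> F" for f
  proof -
    have "(\<Sum>k\<in>J. f k * y k) = (\<Sum>k\<in>J - {b}. h f k * x k)"
      by (simp add: split yb h_def sum_divide_distrib left_diff_distrib sum_subtractf sum_distrib_left mult.assoc)
    then show ?thesis using x that by auto
  qed
  moreover have "(\<Sum>k\<in>J. g k * y k) = 0" using b by (simp add: split yb)
  moreover have "\<forall>k\<in>J. y k \<noteq> 0" using x b by (auto simp: y_def)
  ultimately show ?thesis by blast
qed

section \<open>Consequences of row independence\<close>

lemma independent_rows_three:
  assumes ind: "independent_rows I J a" and "finite I"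
    and I: "i1 \<in> I" "i2 \<in> I" "i3 \<in> I" "distinct [i1, i2, i3]"
    and "c1 \<noteq> 0 \<or> c2 \<noteq> 0 \<or> c3 \<noteq> 0"
  shows "\<exists>k\<in>J. c1 * a i1 k + c2 * a i2 k + c3 * a i3 k \<noteq> 0"
proof (rule ccontr)
  define c where "c i = (if i = i1 then c1 else 0) + (if i = i2 then c2 else 0)
    + (if i = i3 then c3 else 0)" for i
  assume "\<not> ?thesis"
  moreover have "(\<Sum>i\<in>I. c i * a i k) = c1 * a i1 k + c2 * a i2 k + c3 * a i3 k" for k
  proof -
    have "(\<Sum>i\<in>I. c i * a i k) = (\<Sum>i\<in>I. (if i = i1 then c1 * a i k else 0)
        + (if i = i2 then c2 * a i k else 0) + (if i = i3 then c3 * a i k else 0))"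
      by (intro sum.cong) (auto simp: c_def algebra_simps)
    also have "\<dots> = c1 * a i1 k + c2 * a i2 k + c3 * a i3 k"
      using I \<open>finite I\<close> by (simp add: sum.distrib)
    finally show ?thesis .
  qed
  ultimately have "\<forall>i\<in>I. c i = 0" using ind unfolding independent_rows_def by auto
  then have "c i1 = 0" "c i2 = 0" "c i3 = 0" using I by auto
  then show False using assms by (auto simp: c_def)
qed

text \<open>A relation among these rows holds in column \<open>j\<close> automatically, so extending
  it by zero gives a relation among all rows.\<close>

lemma independent_rows_vanishing_column:
  assumes ind: "independent_rows I (insert j J) a" and "finite I"
  shows "independent_rows {i\<in>I. a i j = 0} J a"
  unfolding independent_rows_def
proof (intro allI impI)
  fix c assume c: "\<forall>k\<in>J. (\<Sum>i\<in>{i\<in>I. a i j = 0}. c i * a i k) = 0"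
  define c' where "c' i = (if a i j = 0 then c i else 0)" for i
  have sum: "(\<Sum>i\<in>I. c' i * a i k) = (\<Sum>i\<in>{i\<in>I. a i j = 0}. c i * a i k)" for k
    using \<open>finite I\<close> by (intro sum.mono_neutral_cong_right) (auto simp: c'_def)
  have "\<forall>k\<in>insert j J. (\<Sum>i\<in>I. c' i * a i k) = 0" using c by (auto simp: sum)
  then have "\<forall>i\<in>I. c' i = 0" using ind unfolding independent_rows_def by blast
  then show "\<forall>i\<in>{i\<in>I. a i j = 0}. c i = 0" by (auto simp: c'_def)
qed

lemma independent_rows_nonzero:
  assumes ind: "independent_rows I J a" and "finite I" "i \<in> I"
  shows "\<exists>k\<in>J. a i k \<noteq> 0"
proof (rule ccontr)
  define c where "c i' = (if i' = i then 1 else 0 :: 'c)" for i'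
  assume "\<not> ?thesis"
  moreover have "(\<Sum>i'\<in>I. c i' * a i' k) = a i k" for k
    using assms by (subst sum.cong[OF refl, of _ _ "\<lambda>i'. if i' = i then a i' k else 0"])
      (auto simp: c_def)
  ultimately have "c i = 0"
    using ind \<open>i \<in> I\<close> unfolding independent_rows_def by auto
  then show False by (simp add: c_def)
qed

section \<open>Making two forbidden values coincide\<close>

text \<open>Scale three rows to have entry 1 in column \<open>j\<close>. Two of their differences
  are linearly independent and the third is their sum; if each of the two has a single nonzero
  entry, these lie in different columns and the sum has both.\<close>

lemma row_difference_two_entries:
  fixes a :: "'i \<Rightarrow> 'j \<Rightarrow> 'k::field"
  assumes ind: "independent_rows I J a" "finite I" and card: "3 \<le> card {i\<in>I. a i j \<noteq> 0}"
  obtains i i' l l' where "i \<in> I" "i' \<in> I" "i \<noteq> i'" "a i j \<noteq> 0" "a i' j \<noteq> 0"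
    "l \<in> J" "l' \<in> J" "l \<noteq> l'"
    "a i l / a i j - a i' l / a i' j \<noteq> 0" "a i l' / a i j - a i' l' / a i' j \<noteq> 0"
proof -
  obtain T where "T \<subseteq> {i\<in>I. a i j \<noteq> 0}" "card T = 3"
    using obtain_subset_with_card_n[OF card] by blast
  then obtain i1 i2 i3 where i: "i1 \<in> I" "i2 \<in> I" "i3 \<in> I" "distinct [i1, i2, i3]"
      and nz: "a i1 j \<noteq> 0" "a i2 j \<noteq> 0" "a i3 j \<noteq> 0"
    by (auto simp: card_3_iff)
  define N where "N i i' k = a i k / a i j - a i' k / a i' j" for i i' k
  obtain l where l: "l \<in> J" "N i1 i2 l \<noteq> 0"
    using independent_rows_three[OF ind i, of "1 / a i1 j" "- 1 / a i2 j" 0] nz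
    by (auto simp: N_def)
  \<comment> \<open>With this \<open>s\<close>, the form \<open>N i2 i3 - s * N i1 i2\<close>
    vanishes at \<open>l\<close>, so any column where it is nonzero differs from
    \<open>l\<close>.\<close>
  define s where "s = N i2 i3 l / N i1 i2 l"
  have "- s / a i1 j * a i1 k + (1 + s) / a i2 j * a i2 k + - 1 / a i3 j * a i3 k
      = N i2 i3 k - s * N i1 i2 k" for k
    by (simp add: N_def algebra_simps add_divide_distrib)
  then obtain l' where l': "l' \<in> J" "N i2 i3 l' \<noteq> s * N i1 i2 l'"
    using independent_rows_three[OF ind i, of "- s / a i1 j" "(1 + s) / a i2 j" "- 1 / a i3 j"] nz
    by auto
  have ne: "l \<noteq> l'" using l l' by (auto simp: s_def)
  have N13: "N i1 i3 k = N i1 i2 k + N i2 i3 k" for k by (simp add: N_def)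
  consider "N i1 i2 l' \<noteq> 0" | "N i2 i3 l' \<noteq> 0" "N i2 i3 l \<noteq> 0"
    | "N i1 i3 l' \<noteq> 0" "N i1 i3 l \<noteq> 0"
    using l l' by (cases "N i1 i2 l' = 0"; cases "N i2 i3 l = 0") (auto simp: N13 s_def)
  then show thesis
    using that[of i1 i2 l l'] that[of i2 i3 l l'] that[of i1 i3 l l'] i nz l l' ne
    by cases (auto simp: N_def)
qed

text \<open>A root of the difference \<open>g\<close> of two scaled rows makes their forbidden
  values equal. The forms to keep nonzero are the rows vanishing at \<open>j\<close>. At least three
  rows do not vanish there, so at most q - 3 forms remain, as \<open>nowhere_zero_root\<close>
  requires.\<close>

lemma coinciding_roots:
  fixes a :: "'i \<Rightarrow> 'j \<Rightarrow> 'k::{field,finite}"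
  assumes ind: "independent_rows I (insert j J) a" and fin: "finite I" "finite J"
    and card: "3 \<le> card {i\<in>I. a i j \<noteq> 0}" "card I \<le> CARD('k)"
  obtains x i i' where "\<forall>k\<in>J. x k \<noteq> 0"
    "\<And>r. r \<in> I \<Longrightarrow> a r j = 0 \<Longrightarrow> (\<Sum>k\<in>J. a r k * x k) \<noteq> 0"
    "i \<in> I" "i' \<in> I" "i \<noteq> i'" "a i j \<noteq> 0" "a i' j \<noteq> 0"
    "(\<Sum>k\<in>J. a i k * x k) / a i j = (\<Sum>k\<in>J. a i' k * x k) / a i' j"
proof -
  obtain i i' l l' where i: "i \<in> I" "i' \<in> I" "i \<noteq> i'" "a i j \<noteq> 0" "a i' j \<noteq> 0"
    and l: "l \<in> insert j J" "l' \<in> insert j J" "l \<noteq> l'"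
      "a i l / a i j - a i' l / a i' j \<noteq> 0" "a i l' / a i j - a i' l' / a i' j \<noteq> 0"
    using row_difference_two_entries[OF ind fin(1) card(1)] by blast
  define g where "g k = a i k / a i j - a i' k / a i' j" for k
  define R where "R = {r\<in>I. a r j = 0}"
  have "card I = card R + card {i\<in>I. a i j \<noteq> 0}"
    unfolding R_def using fin by (subst card_Un_disjoint[symmetric]) (auto intro: arg_cong[where f = card])
  moreover have "card (a ` R) \<le> card R" using fin by (intro card_image_le) (auto simp: R_def)
  ultimately have cardR: "card (a ` R) + 3 \<le> CARD('k)" using card by linarith
  \<comment> \<open>A row \<open>f = s * g\<close> would be a relation among three distinct rows.
    Column \<open>j\<close> cannot be the witness against it, since \<open>f\<close> and
    \<open>g\<close> both vanish there.\<close>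
  have multiple: "\<exists>k\<in>J. f k \<noteq> s * g k" if f: "f \<in> a ` R" for f s
  proof -
    obtain r where r: "r \<in> I" "a r j = 0" "f = a r" using f by (auto simp: R_def)
    then have "distinct [r, i, i']" using i by auto
    then have "\<exists>k\<in>insert j J. 1 * a r k + (- s / a i j) * a i k + (s / a i' j) * a i' k \<noteq> 0"
      by (intro independent_rows_three[OF ind fin(1) r(1) i(1,2)]) auto
    moreover have "1 * a r k + (- s / a i j) * a i k + (s / a i' j) * a i' k = f k - s * g k" for k
      by (simp add: r g_def algebra_simps)
    ultimately have "\<exists>k\<in>insert j J. f k - s * g k \<noteq> 0" by (simp only:)
    then obtain k where k: "k \<in> insert j J" "f k \<noteq> s * g k"
      unfolding right_minus_eq by blast
    moreover have "k \<noteq> j" using k r i by (auto simp: g_def)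
    ultimately show ?thesis by auto
  qed
  have "l \<in> J" "l' \<in> J" using i l by auto
  then obtain x where x: "\<forall>k\<in>J. x k \<noteq> 0" "(\<Sum>k\<in>J. g k * x k) = 0"
      "\<forall>f\<in>a ` R. (\<Sum>k\<in>J. f k * x k) \<noteq> 0"
    using nowhere_zero_root[of J "a ` R" l g l', OF fin(2) _ cardR _ _ _ _ _ multiple] l fin
    by (auto simp: g_def R_def)
  have "(\<Sum>k\<in>J. a i k * x k) / a i j - (\<Sum>k\<in>J. a i' k * x k) / a i' j = (\<Sum>k\<in>J. g k * x k)"
    by (simp add: g_def left_diff_distrib sum_subtractf sum_divide_distrib)
  then show thesis using that[of x i i'] x i by (auto simp: R_def)
qed

section \<open>Matrices with a column that has few nonzero entries\<close>

text \<open>Rows and columns are separate sets because the induction drops one column but possibly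
  several rows.\<close>

lemma nonvanishing_sparse_column:
  fixes a :: "'i \<Rightarrow> 'j \<Rightarrow> 'k::{field,finite}"
  assumes "4 \<le> CARD('k)" "finite I" "finite J" "independent_rows I J a" "card I \<le> CARD('k)"
    "j \<in> J" "card {i\<in>I. a i j \<noteq> 0} < CARD('k)" "\<exists>i\<in>I. a i j \<noteq> 0"
  shows "\<exists>x. (\<forall>k\<in>J. x k \<noteq> 0) \<and> (\<forall>i\<in>I. (\<Sum>k\<in>J. a i k * x k) \<noteq> 0)"
  using assms(2-)
proof (induction "card I" arbitrary: I J j rule: less_induct)
  case less
  define J' where "J' = J - {j}"
  have J: "J = insert j J'" "finite J'" "j \<notin> J'" using less.prems by (auto simp: J'_def)
  have ind: "independent_rows I (insert j J') a" using less.prems J by simp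
  let ?K = "{i\<in>I. a i j \<noteq> 0}" and ?R = "{i\<in>I. a i j = 0}"
  let ?root = "\<lambda>x i. (\<Sum>k\<in>J'. a i k * x k) / a i j"
  have "\<exists>x. (\<forall>k\<in>J'. x k \<noteq> 0) \<and> (\<forall>r\<in>?R. (\<Sum>k\<in>J'. a r k * x k) \<noteq> 0)
      \<and> card (?root x ` ?K) + 2 \<le> CARD('k)"
  proof (cases "3 \<le> card ?K")
    case True
    obtain x i i' where x: "\<forall>k\<in>J'. x k \<noteq> 0"
        "\<And>r. r \<in> I \<Longrightarrow> a r j = 0 \<Longrightarrow> (\<Sum>k\<in>J'. a r k * x k) \<noteq> 0"
      and i: "i \<in> I" "i' \<in> I" "i \<noteq> i'" "a i j \<noteq> 0" "a i' j \<noteq> 0" "?root x i = ?root x i'"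
      by (rule coinciding_roots[OF ind less.prems(1) J(2) True less.prems(4)]) blast
    \<comment> \<open>Rows \<open>i\<close> and \<open>i'\<close> forbid the same value, so
      \<open>card ?K - 1\<close>, which is at most q - 2, bounds the number of forbidden
      values.\<close>
    have "?root x ` ?K \<subseteq> ?root x ` (?K - {i'})"
    proof
      fix t assume "t \<in> ?root x ` ?K"
      then obtain m where "m \<in> ?K" "t = ?root x m" by blast
      then show "t \<in> ?root x ` (?K - {i'})"
        using i by (cases "m = i'") (auto intro!: image_eqI[of _ _ i])
    qed
    then have "card (?root x ` ?K) \<le> card (?root x ` (?K - {i'}))"
      using less.prems by (intro card_mono) auto
    also have "\<dots> \<le> card (?K - {i'})" using less.prems by (intro card_image_le) auto
    also have "\<dots> = card ?K - 1" using i less.prems by (subst card_Diff_singleton) auto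
    finally show ?thesis using x less.prems True by (intro exI[of _ x]) auto
  next
    case False
    \<comment> \<open>Column \<open>j\<close> forbids at most two values and q is at least 4, so
      \<open>x\<close> only has to suit the rows in \<open>?R\<close>.\<close>
    have "\<exists>x. (\<forall>k\<in>J'. x k \<noteq> 0) \<and> (\<forall>r\<in>?R. (\<Sum>k\<in>J'. a r k * x k) \<noteq> 0)"
    proof (cases "?R = {}")
      case True
      show ?thesis unfolding True by (rule exI[of _ "\<lambda>_. 1"]) auto
    next
      case False
      then obtain r where r: "r \<in> ?R" by blast
      have R: "card ?R < card I" using less.prems by (intro psubset_card_mono) auto
      have indR: "independent_rows ?R J' a"
        using independent_rows_vanishing_column[OF ind less.prems(1)] .
      then obtain k where k: "k \<in> J'" "a r k \<noteq> 0"
        using independent_rows_nonzero[of ?R J' a r] r less.prems by auto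
      \<comment> \<open>\<open>?R\<close> has fewer than q rows, so the sparsity hypothesis holds
        for every column of the smaller system; \<open>k\<close> only has to be nonzero somewhere on
        \<open>?R\<close>.\<close>
      have "card {i\<in>?R. a i k \<noteq> 0} \<le> card ?R" using less.prems by (intro card_mono) auto
      then show ?thesis
        using less.hyps[OF R _ J(2) indR _ k(1)] R k r less.prems by auto
    qed
    then obtain x where x: "\<forall>k\<in>J'. x k \<noteq> 0" "\<forall>r\<in>?R. (\<Sum>k\<in>J'. a r k * x k) \<noteq> 0"
      by blast
    have "card (?root x ` ?K) \<le> card ?K"
      using less.prems by (intro card_image_le) auto
    then have "card (?root x ` ?K) + 2 \<le> CARD('k)" using False assms(1) by linarith
    with x show ?thesis by blast
  qed
  then obtain x where x: "\<forall>k\<in>J'. x k \<noteq> 0" "\<forall>r\<in>?R. (\<Sum>k\<in>J'. a r k * x k) \<noteq> 0"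
    "card (?root x ` ?K) + 2 \<le> CARD('k)" by blast
  show ?case unfolding J(1)
    by (rule extend_nonvanishing[OF J(2,3) x(1) _ x(3)]) (use x(2) in auto)
qed

section \<open>Making three forbidden values coincide\<close>

text \<open>When three rows forbid the same value, at most \<open>card I - 2\<close> values are
  forbidden. This takes a nowhere zero common root of two differences of scaled rows;
  \<open>comb\<close> keeps these differences independent even after deletion of a
  coordinate.\<close>

lemma nonvanishing_three_rows:
  fixes a :: "'i \<Rightarrow> 'j \<Rightarrow> 'k::{field,finite}"
  assumes q: "4 \<le> CARD('k)" and fin: "finite I" "finite J" and card: "card I \<le> CARD('k)"
    and j: "j \<in> J" "\<And>i. i \<in> I \<Longrightarrow> a i j \<noteq> 0"
    and i: "i1 \<in> I" "i2 \<in> I" "i3 \<in> I" "distinct [i1, i2, i3]"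
    and comb: "\<And>l c1 c2 c3. c1 \<noteq> 0 \<or> c2 \<noteq> 0 \<or> c3 \<noteq> 0 \<Longrightarrow>
      \<exists>k\<in>J - {l}. c1 * a i1 k + c2 * a i2 k + c3 * a i3 k \<noteq> 0"
  shows "\<exists>x. (\<forall>k\<in>J. x k \<noteq> 0) \<and> (\<forall>i\<in>I. (\<Sum>k\<in>J. a i k * x k) \<noteq> 0)"
proof -
  define J' where "J' = J - {j}"
  have J: "J = insert j J'" "finite J'" "j \<notin> J'" using j fin by (auto simp: J'_def)
  have nz: "a i1 j \<noteq> 0" "a i2 j \<noteq> 0" "a i3 j \<noteq> 0" using i j by auto
  define f where "f k = a i1 k / a i1 j - a i2 k / a i2 j" for k
  define g where "g k = a i1 k / a i1 j - a i3 k / a i3 j" for k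
  have fg: "\<exists>k\<in>J' - {l}. s * f k + t * g k \<noteq> 0" if "s \<noteq> 0 \<or> t \<noteq> 0" for s t l
  proof -
    have "- s / a i2 j \<noteq> 0 \<or> - t / a i3 j \<noteq> 0" using that nz by auto
    then obtain k where k: "k \<in> J - {l}"
        "(s + t) / a i1 j * a i1 k + (- s / a i2 j) * a i2 k + (- t / a i3 j) * a i3 k \<noteq> 0"
      using comb[of "(s + t) / a i1 j" "- s / a i2 j" "- t / a i3 j" l] by blast
    have "(s + t) / a i1 j * a i1 k + (- s / a i2 j) * a i2 k + (- t / a i3 j) * a i3 k
        = s * f k + t * g k"
      by (simp add: f_def g_def algebra_simps add_divide_distrib)
    moreover have "f j = 0" "g j = 0" using nz by (auto simp: f_def g_def)
    ultimately show ?thesis using k by (intro bexI[of _ k]) (auto simp: J'_def)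
  qed
  obtain b where b: "b \<in> J'" "f b \<noteq> 0" using fg[of 1 0 j] by auto
  \<comment> \<open>Eliminating coordinate \<open>b\<close> leaves one equation
    \<open>h = 0\<close>. It is solved off \<open>b\<close> with \<open>f\<close> kept nonzero
    there, so that solving \<open>f = 0\<close> for coordinate \<open>b\<close> then gives a nonzero
    value.\<close>
  define h where "h k = g k - g b / f b * f k" for k
  have hb: "h b = 0" using b by (simp add: h_def)
  obtain c where c: "c \<in> J'" "h c \<noteq> 0"
    using fg[of "- g b / f b" 1 j] by (auto simp: h_def algebra_simps)
  \<comment> \<open>Deleting coordinate \<open>c\<close> in \<open>fg\<close> yields the second
    nonzero entry of \<open>h\<close>, which \<open>nowhere_zero_root\<close> needs.\<close>
  obtain e where e: "e \<in> J'" "h e \<noteq> 0" "e \<noteq> c"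
    using fg[of "- g b / f b" 1 c] by (auto simp: h_def algebra_simps)
  have multiple: "\<exists>k\<in>J' - {b}. f' k \<noteq> s * h k" if "f' \<in> {f}" for f' s
  proof -
    have "\<exists>k\<in>J' - {b}. (1 + s * g b / f b) * f k + (- s) * g k \<noteq> 0"
      by (rule fg) auto
    then show ?thesis using that by (auto simp: h_def algebra_simps)
  qed
  obtain x where x: "\<forall>k\<in>J' - {b}. x k \<noteq> 0" "(\<Sum>k\<in>J' - {b}. h k * x k) = 0"
      "(\<Sum>k\<in>J' - {b}. f k * x k) \<noteq> 0"
    using nowhere_zero_root[of "J' - {b}" "{f}" c h e, OF _ _ _ _ _ _ _ _ multiple] c e hb J q
    by auto
  define y where "y = x(b := - (\<Sum>k\<in>J' - {b}. f k * x k) / f b)"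
  have yb: "y b = - (\<Sum>k\<in>J' - {b}. f k * x k) / f b" by (simp add: y_def)
  have split: "(\<Sum>k\<in>J'. u k * y k) = u b * y b + (\<Sum>k\<in>J' - {b}. u k * x k)" for u
  proof -
    have "(\<Sum>k\<in>J' - {b}. u k * y k) = (\<Sum>k\<in>J' - {b}. u k * x k)"
      by (intro sum.cong) (auto simp: y_def)
    then show ?thesis using sum.remove[OF J(2) b(1), of "\<lambda>k. u k * y k"] by simp
  qed
  have f0: "(\<Sum>k\<in>J'. f k * y k) = 0" using b by (simp add: split yb)
  have "(\<Sum>k\<in>J'. h k * y k) = 0" using x hb by (simp add: split)
  moreover have "(\<Sum>k\<in>J'. h k * y k) = (\<Sum>k\<in>J'. g k * y k) - g b / f b * (\<Sum>k\<in>J'. f k * y k)"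
    by (simp add: h_def left_diff_distrib sum_subtractf sum_distrib_left mult.assoc)
  ultimately have g0: "(\<Sum>k\<in>J'. g k * y k) = 0" using f0 by simp
  let ?root = "\<lambda>i. (\<Sum>k\<in>J'. a i k * y k) / a i j"
  have "?root i1 - ?root i2 = (\<Sum>k\<in>J'. f k * y k)" "?root i1 - ?root i3 = (\<Sum>k\<in>J'. g k * y k)"
    by (simp_all add: f_def g_def left_diff_distrib sum_subtractf sum_divide_distrib)
  then have root: "?root i2 = ?root i1" "?root i3 = ?root i1" using f0 g0 by simp_all
  have K: "{i\<in>I. a i j \<noteq> 0} = I" using j by auto
  have "?root ` I \<subseteq> ?root ` (I - {i2, i3})"
  proof
    fix t assume "t \<in> ?root ` I"
    then obtain i where "i \<in> I" "t = ?root i" by blast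
    then show "t \<in> ?root ` (I - {i2, i3})"
      using root i by (cases "i \<in> {i2, i3}") (auto intro!: image_eqI[of _ _ i1])
  qed
  then have "card (?root ` I) \<le> card (?root ` (I - {i2, i3}))"
    using fin by (intro card_mono) auto
  also have "\<dots> \<le> card (I - {i2, i3})" using fin by (intro card_image_le) auto
  also have "\<dots> = card I - 2" using i fin by (subst card_Diff_subset) auto
  finally have "card (?root ` {i\<in>I. a i j \<noteq> 0}) + 2 \<le> CARD('k)"
    unfolding K using card q by linarith
  moreover have y: "\<forall>k\<in>J'. y k \<noteq> 0" using x b by (auto simp: y_def)
  ultimately show ?thesis unfolding J(1)
    by (intro extend_nonvanishing[OF J(2,3) y]) (simp_all add: j)
qed

section \<open>Matrices and their inverses\<close>

lemma sum_mult_right_inverse: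
  fixes a b :: "nat \<Rightarrow> nat \<Rightarrow> 'k::field"
  assumes ab: "\<And>i j. i < d \<Longrightarrow> j < d \<Longrightarrow> (\<Sum>k<d. a i k * b k j) = (if i = j then 1 else 0)"
    and "j < d"
  shows "(\<Sum>k<d. (\<Sum>i<d. c i * a i k) * b k j) = c j"
proof -
  have "(\<Sum>k<d. (\<Sum>i<d. c i * a i k) * b k j) = (\<Sum>i<d. c i * (\<Sum>k<d. a i k * b k j))"
    by (simp add: sum_distrib_left sum_distrib_right mult.assoc) (rule sum.swap)
  also have "\<dots> = (\<Sum>i<d. if i = j then c i else 0)"
    using ab \<open>j < d\<close> by (intro sum.cong) auto
  finally show ?thesis using \<open>j < d\<close> by simp
qed

text \<open>The right inverse makes the rows independent, the left inverse excludes a zero column,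
  and the zero entry leaves fewer than d nonzero entries in column \<open>j\<close>.\<close>

lemma nonvanishing_zero_entry:
  fixes a b :: "nat \<Rightarrow> nat \<Rightarrow> 'k::{field,finite}"
  assumes ab: "\<And>i j. i < d \<Longrightarrow> j < d \<Longrightarrow> (\<Sum>k<d. a i k * b k j) = (if i = j then 1 else 0)"
    and ba: "\<And>i j. i < d \<Longrightarrow> j < d \<Longrightarrow> (\<Sum>k<d. b i k * a k j) = (if i = j then 1 else 0)"
    and q: "4 \<le> CARD('k)" "d \<le> CARD('k)" and j: "j < d" and i: "i < d" "a i j = 0"
  shows "\<exists>x. (\<forall>k<d. x k \<noteq> 0) \<and> (\<forall>i<d. (\<Sum>k<d. a i k * x k) \<noteq> 0)"
proof -
  have "independent_rows {..<d} {..<d} a"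
    unfolding independent_rows_def
  proof (intro allI impI ballI)
    fix c i assume "\<forall>j\<in>{..<d}. (\<Sum>i<d. c i * a i j) = 0" "i \<in> {..<d}"
    then show "c i = 0" using sum_mult_right_inverse[of d a b i c, OF ab] by simp
  qed
  moreover have "card {i\<in>{..<d}. a i j \<noteq> 0} < card {..<d}"
    using i by (intro psubset_card_mono) auto
  moreover have "\<exists>i\<in>{..<d}. a i j \<noteq> 0"
  proof (rule ccontr)
    assume "\<not> ?thesis"
    then have "(\<Sum>k<d. b j k * a k j) = 0" by (intro sum.neutral) auto
    then show False using ba[OF j j] by simp
  qed
  ultimately show ?thesis
    using nonvanishing_sparse_column[of "{..<d}" "{..<d}" a j] q j by auto
qed

text \<open>If a combination of rows 0, 1, 2 vanishes off column \<open>l\<close>, multiplying by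
  the inverse shows that its coefficient vector is a multiple of row \<open>l\<close> of
  \<open>b\<close>. Its coefficient at index 3 is zero while \<open>b l 3\<close> is not, so the
  multiple is zero.\<close>

lemma nonvanishing_no_zero_entry:
  fixes a b :: "nat \<Rightarrow> nat \<Rightarrow> 'k::{field,finite}"
  assumes ab: "\<And>i j. i < d \<Longrightarrow> j < d \<Longrightarrow> (\<Sum>k<d. a i k * b k j) = (if i = j then 1 else 0)"
    and q: "4 \<le> d" "d \<le> CARD('k)"
    and a: "\<And>i j. i < d \<Longrightarrow> j < d \<Longrightarrow> a i j \<noteq> 0"
    and b: "\<And>i j. i < d \<Longrightarrow> j < d \<Longrightarrow> b i j \<noteq> 0"
  shows "\<exists>x. (\<forall>k<d. x k \<noteq> 0) \<and> (\<forall>i<d. (\<Sum>k<d. a i k * x k) \<noteq> 0)"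
proof -
  have comb: "\<exists>k\<in>{..<d} - {l}. c0 * a 0 k + c1 * a 1 k + c2 * a 2 k \<noteq> 0"
    if "c0 \<noteq> 0 \<or> c1 \<noteq> 0 \<or> c2 \<noteq> 0" for l c0 c1 c2
  proof (rule ccontr)
    assume zero: "\<not> ?thesis"
    define c where "c i = (if i = 0 then c0 else 0) + (if i = 1 then c1 else 0)
      + (if i = 2 then c2 else 0)" for i :: nat
    have sum: "(\<Sum>i<d. c i * a i k) = c0 * a 0 k + c1 * a 1 k + c2 * a 2 k" for k
    proof -
      have "(\<Sum>i<d. c i * a i k) = (\<Sum>i<d. (if i = 0 then c0 * a i k else 0)
          + (if i = 1 then c1 * a i k else 0) + (if i = 2 then c2 * a i k else 0))"
        by (intro sum.cong) (auto simp: c_def algebra_simps)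
      also have "\<dots> = c0 * a 0 k + c1 * a 1 k + c2 * a 2 k" using q by (simp add: sum.distrib)
      finally show ?thesis .
    qed
    \<comment> \<open>For \<open>l\<close> outside the range no column is left out, so the
      combination is zero and the factor is 0.\<close>
    define s where "s = (if l < d then \<Sum>i<d. c i * a i l else 0)"
    have row: "c i = s * b l i" if "i < d" for i
    proof -
      have "c i = (\<Sum>k<d. (\<Sum>i<d. c i * a i k) * b k i)"
        using sum_mult_right_inverse[of d a b i c, OF ab that] by simp
      also have "\<dots> = (\<Sum>k<d. if k = l then (\<Sum>i<d. c i * a i l) * b l i else 0)"
        using zero by (intro sum.cong) (auto simp: sum)
      also have "\<dots> = s * b l i" by (auto simp: s_def)
      finally show ?thesis .
    qed
    have "c 3 = 0" by (simp add: c_def)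
    then have "s = 0" using row[of 3] b[of l 3] q by (cases "l < d") (auto simp: s_def)
    then have "c 0 = 0" "c 1 = 0" "c 2 = 0" using row q by auto
    then show False using that by (simp add: c_def)
  qed
  show ?thesis
    using nonvanishing_three_rows[of "{..<d}" "{..<d}" 0 a 0 1 2, OF _ _ _ _ _ _ _ _ _ _ comb] q a
    by auto
qed

theorem theorem22:
  fixes A :: "'k :: {field, finite} mat" and d q :: nat
  assumes "q = card (UNIV :: 'k set)"
    and "q \<ge> d" and "d \<ge> 4"
    and "A \<in> carrier_mat d d"
    and "invertible_mat A"
  shows "\<exists>v \<in> carrier_vec d.
    (\<forall>i<d. v $ i \<noteq> 0) \<and> (\<forall>i<d. (A *\<^sub>v v) $ i \<noteq> 0)"
proof -
  obtain B where "A * B = 1\<^sub>m (dim_row A)" "B * A = 1\<^sub>m (dim_row B)"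
    using assms unfolding invertible_mat_def inverts_mat_def by blast
  \<comment> \<open>The inverse comes without dimensions; they are read off from the column counts
    of the two products.\<close>
  moreover have "dim_row B = d" "dim_col B = d"
    using calculation assms
    by (metis carrier_matD(2) index_mult_mat(3) index_one_mat(3),
        metis carrier_matD(1) index_mult_mat(3) index_one_mat(3))
  ultimately have B: "B \<in> carrier_mat d d" "A * B = 1\<^sub>m d" "B * A = 1\<^sub>m d"
    using assms by auto
  define a b where "a i j = A $$ (i, j)" and "b i j = B $$ (i, j)" for i j
  have prod: "(\<Sum>k<d. X $$ (i, k) * Y $$ (k, j)) = (X * Y) $$ (i, j)"
    if "X \<in> carrier_mat d d" "Y \<in> carrier_mat d d" "i < d" "j < d" for X Y :: "'k mat" and i j
    using that by (auto simp: scalar_prod_def lessThan_atLeast0 intro!: sum.cong)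
  have ab: "(\<Sum>k<d. a i k * b k j) = (if i = j then 1 else 0)" if "i < d" "j < d" for i j
    using prod[of A B] B assms that by (simp add: a_def b_def)
  have ba: "(\<Sum>k<d. b i k * a k j) = (if i = j then 1 else 0)" if "i < d" "j < d" for i j
    using prod[of B A] B assms that by (simp add: a_def b_def)
  have q: "4 \<le> CARD('k)" "d \<le> CARD('k)" "4 \<le> d" using assms by auto
  have "\<exists>x. (\<forall>k<d. x k \<noteq> 0) \<and> (\<forall>i<d. (\<Sum>k<d. a i k * x k) \<noteq> 0)"
  proof -
    consider i j where "i < d" "j < d" "a i j = 0" | i j where "i < d" "j < d" "b i j = 0"
      | "\<And>i j. i < d \<Longrightarrow> j < d \<Longrightarrow> a i j \<noteq> 0" "\<And>i j. i < d \<Longrightarrow> j < d \<Longrightarrow> b i j \<noteq> 0"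
      by blast
    then show ?thesis
    proof cases
      case 1
      then show ?thesis using nonvanishing_zero_entry[of d a b, OF ab ba] q by blast
    next
      case 2
      then obtain x where x: "\<forall>k<d. x k \<noteq> 0" "\<forall>i<d. (\<Sum>k<d. b i k * x k) \<noteq> 0"
        using nonvanishing_zero_entry[of d b a, OF ba ab] q by blast
      \<comment> \<open>The vector sought is B x: it has no zero component, and A maps it back to
        \<open>x\<close>. The lemma is applied to the transposes.\<close>
      have "(\<Sum>k<d. a i k * (\<Sum>l<d. b k l * x l)) = x i" if "i < d" for i
        using sum_mult_right_inverse[of d "\<lambda>i k. b k i" "\<lambda>k i. a i k" i x] ab that
        by (simp add: mult.commute eq_commute)
      then show ?thesis using x by (intro exI[of _ "\<lambda>i. \<Sum>k<d. b i k * x k"]) auto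
    next
      case 3
      then show ?thesis using nonvanishing_no_zero_entry[of d a b, OF ab] q by blast
    qed
  qed
  then obtain x where x: "\<forall>k<d. x k \<noteq> 0" "\<forall>i<d. (\<Sum>k<d. a i k * x k) \<noteq> 0" by blast
  have "(A *\<^sub>v vec d x) $ i = (\<Sum>k<d. a i k * x k)" if "i < d" for i
    using assms that by (auto simp: a_def scalar_prod_def lessThan_atLeast0 intro!: sum.cong)
  then show ?thesis using x by (intro bexI[of _ "vec d x"]) auto
qed

end
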